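(* Let $m,n$ be integers with $2\le m\le 3$ and $n\ge 1$. Every infinite $\mathcal{T}(m,n)$-group is abelian.
   Context: For integers $m\ge 2$ and $n\ge 1$, a group $G$ is called a $\mathcal{T}(m,n)$-group if for every $m$ subsets $X_1,\dots,X_m$ of $G$, each of cardinality $n$, there exist indices $i\ne j$ and elements $x_i\in X_i$, $x_j\in X_j$ such that $x_ix_j=x_jx_i$. *)

theory Defs
  imports "HOL-Algebra.Algebra"
begin

(* The subsets form an indexed family and may coincide or overlap; in those cases the
   condition holds trivially, as an element commutes with itself.  The intended range is
   m >= 2 and n >= 1; for n >= 1, card (S i) = n forces S i to be finite. *)
definition T_group :: "nat \<Rightarrow> nat \<Rightarrow> ('a, 'b) monoid_scheme \<Rightarrow> bool" where
  "T_group m n G \<longleftrightarrow> group G \<and>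
     (\<forall>S :: nat \<Rightarrow> 'a set.
        (\<forall>i\<in>{1..m}. S i \<subseteq> carrier G \<and> card (S i) = n) \<longrightarrow>
        (\<exists>i\<in>{1..m}. \<exists>j\<in>{1..m}. i \<noteq> j \<and>
           (\<exists>x\<in>S i. \<exists>y\<in>S j. x \<otimes>\<^bsub>G\<^esub> y = y \<otimes>\<^bsub>G\<^esub> x)))"

end

theory Submission
  imports Defs "HOL-Library.Ramsey"
begin

text \<open>
  An infinite set of pairwise non-commuting elements could be cut into m blocks of size n, so by
  Ramsey's theorem every infinite subset of G has an infinite commuting subset.  Applying this to G,
  then to a translate by g, then to a translate by h, yields an infinite commuting set D that
  centralizes both g and h: if a, b and ga, gb commute, then so do g and the quotient of a by b.
  If g and h did not commute, then gD, hD and ghD would be pairwise totally non-commuting.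
\<close>

lemma T_group_infinite_commuting_subset:
  assumes T: "T_group m n G" and Z: "Z \<subseteq> carrier G" "infinite Z"
  shows "\<exists>Y\<subseteq>Z. infinite Y \<and> (\<forall>x\<in>Y. \<forall>y\<in>Y. x \<otimes>\<^bsub>G\<^esub> y = y \<otimes>\<^bsub>G\<^esub> x)"
proof -
  \<comment> \<open>Colour 0 marks a commuting pair, colour 1 a non-commuting one. Ramsey's theorem
    constrains only pairs of distinct elements, so the case \<open>x = y\<close> is settled
    separately by reflexivity.\<close>
  define f :: "'a set \<Rightarrow> nat" where
    "f e = (if \<exists>x\<in>e. \<exists>y\<in>e. x \<otimes>\<^bsub>G\<^esub> y \<noteq> y \<otimes>\<^bsub>G\<^esub> x then 1 else 0)" for e
  have "\<forall>x\<in>Z. \<forall>y\<in>Z. x \<noteq> y \<longrightarrow> f {x, y} < 2"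
    by (auto simp: f_def)
  from Ramsey2[OF Z(2) this] obtain Y t where Y: "Y \<subseteq> Z" "infinite Y" and "t < 2"
    and t: "\<And>x y. x \<in> Y \<Longrightarrow> y \<in> Y \<Longrightarrow> x \<noteq> y \<Longrightarrow> f {x, y} = t"
    by blast
  show ?thesis
  proof (cases "t = 0")
    case True
    have "x \<otimes>\<^bsub>G\<^esub> y = y \<otimes>\<^bsub>G\<^esub> x" if "x \<in> Y" "y \<in> Y" for x y
      using t[OF that] True by (cases "x = y") (auto simp: f_def split: if_splits)
    with Y show ?thesis by blast
  next
    case False
    have noncomm: "x \<otimes>\<^bsub>G\<^esub> y \<noteq> y \<otimes>\<^bsub>G\<^esub> x" if "x \<in> Y" "y \<in> Y" "x \<noteq> y" for x y
      using t[OF that] False by (auto simp: f_def split: if_splits)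
    obtain e :: "nat \<Rightarrow> 'a" where e: "inj e" "range e \<subseteq> Y"
      using Y(2) infinite_countable_subset by blast
    \<comment> \<open>Consecutive blocks of length \<open>n\<close> in an injective sequence are
      pairwise disjoint. Commuting elements taken from two different blocks are therefore distinct
      elements of \<open>Y\<close>, which colour 1 forbids.\<close>
    define S where "S i = e ` {i * n..<i * n + n}" for i
    have "\<forall>i\<in>{1..m}. S i \<subseteq> carrier G \<and> card (S i) = n"
    proof
      fix i
      have "card (S i) = n"
        unfolding S_def using e(1) by (simp add: card_image inj_on_subset)
      moreover have "S i \<subseteq> carrier G"
        unfolding S_def using e(2) Y(1) Z(1) by blast
      ultimately show "S i \<subseteq> carrier G \<and> card (S i) = n" by simp
    qed
    with T obtain i j x y where "i \<noteq> j" and xy: "x \<in> S i" "y \<in> S j"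
      "x \<otimes>\<^bsub>G\<^esub> y = y \<otimes>\<^bsub>G\<^esub> x"
      unfolding T_group_def by metis
    moreover have "S i \<inter> S j = {}"
    proof -
      have "i = j" if "k \<in> {i * n..<i * n + n}" "k \<in> {j * n..<j * n + n}" for k
      proof -
        \<comment> \<open>Division by \<open>n\<close> recovers the block number from any position
          in the block.\<close>
        have "k div n = l" if "k \<in> {l * n..<l * n + n}" for l
          using that by (intro div_nat_eqI) (auto simp: algebra_simps)
        with that show ?thesis by metis
      qed
      with \<open>i \<noteq> j\<close> have "{i * n..<i * n + n} \<inter> {j * n..<j * n + n} = {}"
        by blast
      then show ?thesis
        unfolding S_def using e(1) by (metis image_Int image_empty)
    qed
    moreover have "S i \<subseteq> Y" "S j \<subseteq> Y"
      using e(2) by (auto simp: S_def)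
    ultimately show ?thesis
      using noncomm by blast
  qed
qed

text \<open>Cancelling the leading \<open>g\<close> in \<open>gab\<close> leaves
  \<open>a g b = b g a\<close>. Multiplying by \<open>inv b\<close> on both sides turns this into
  \<open>(inv b a) g = g (a inv b)\<close>, and \<open>a\<close> commutes with \<open>inv b\<close>
  because it commutes with \<open>b\<close>.\<close>

lemma (in group) commute_quotient:
  assumes [simp]: "g \<in> carrier G" "a \<in> carrier G" "b \<in> carrier G"
    and ab: "a \<otimes> b = b \<otimes> a"
    and gab: "(g \<otimes> a) \<otimes> (g \<otimes> b) = (g \<otimes> b) \<otimes> (g \<otimes> a)"
  shows "g \<otimes> (inv b \<otimes> a) = (inv b \<otimes> a) \<otimes> g"
proof -
  have ba: "inv b \<otimes> a = a \<otimes> inv b"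
    using ab by (metis assms(2,3) inv_solve_left inv_solve_right m_assoc m_closed inv_closed)
  have "a \<otimes> g \<otimes> b = b \<otimes> g \<otimes> a"
    using gab by (simp add: m_assoc)
  then have "inv b \<otimes> (a \<otimes> g \<otimes> b) \<otimes> inv b = inv b \<otimes> (b \<otimes> g \<otimes> a) \<otimes> inv b"
    by simp
  moreover have "inv b \<otimes> (a \<otimes> g \<otimes> b) \<otimes> inv b = (inv b \<otimes> a) \<otimes> g"
    by (simp add: m_assoc)
  moreover have "inv b \<otimes> (b \<otimes> g \<otimes> a) \<otimes> inv b = g \<otimes> (a \<otimes> inv b)"
    by (simp add: m_assoc[symmetric])
  ultimately show ?thesis
    using ba by simp
qed

text \<open>Swapping the inner factors turns the two products into \<open>(x y)(a b)\<close> and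
  \<open>(y x)(a b)\<close>, and \<open>a b\<close> cancels. The direction from right to left, with
  \<open>x = y\<close>, produces commuting translates; the other direction gives the final
  contradiction.\<close>

lemma (in group) commute_translates_iff:
  assumes [simp]: "x \<in> carrier G" "y \<in> carrier G" "a \<in> carrier G" "b \<in> carrier G"
    and c: "y \<otimes> a = a \<otimes> y" "x \<otimes> b = b \<otimes> x" "a \<otimes> b = b \<otimes> a"
  shows "(x \<otimes> a) \<otimes> (y \<otimes> b) = (y \<otimes> b) \<otimes> (x \<otimes> a) \<longleftrightarrow> x \<otimes> y = y \<otimes> x"
proof -
  have "(x \<otimes> a) \<otimes> (y \<otimes> b) = x \<otimes> (y \<otimes> a) \<otimes> b"
    by (simp add: m_assoc c(1))
  then have 1: "(x \<otimes> a) \<otimes> (y \<otimes> b) = (x \<otimes> y) \<otimes> (a \<otimes> b)"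
    by (simp add: m_assoc)
  have "(y \<otimes> b) \<otimes> (x \<otimes> a) = y \<otimes> (x \<otimes> b) \<otimes> a"
    by (simp add: m_assoc c(2))
  then have "(y \<otimes> b) \<otimes> (x \<otimes> a) = (y \<otimes> x) \<otimes> (a \<otimes> b)"
    by (simp add: m_assoc c(3))
  with 1 show ?thesis by simp
qed

text \<open>Left multiplication by \<open>g\<close> is injective, so the translate of
  \<open>A\<close> is again infinite; an infinite commuting subset of it is pulled back to
  \<open>A\<close>.\<close>

lemma T_group_infinite_commuting_translate:
  assumes T: "T_group m n G" and A: "A \<subseteq> carrier G" "infinite A" and g: "g \<in> carrier G"
  shows "\<exists>B\<subseteq>A. infinite B \<and> (\<forall>a\<in>B. \<forall>b\<in>B.
    (g \<otimes>\<^bsub>G\<^esub> a) \<otimes>\<^bsub>G\<^esub> (g \<otimes>\<^bsub>G\<^esub> b) = (g \<otimes>\<^bsub>G\<^esub> b) \<otimes>\<^bsub>G\<^esub> (g \<otimes>\<^bsub>G\<^esub> a))"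
proof -
  interpret group G using T by (simp add: T_group_def)
  have "inj_on ((\<otimes>\<^bsub>G\<^esub>) g) A"
    using A(1) g inj_on_cmult inj_on_subset by blast
  then have "infinite ((\<otimes>\<^bsub>G\<^esub>) g ` A)"
    using A(2) by (simp add: finite_image_iff)
  moreover have "(\<otimes>\<^bsub>G\<^esub>) g ` A \<subseteq> carrier G"
    using A(1) g by auto
  ultimately obtain Y where Y: "Y \<subseteq> (\<otimes>\<^bsub>G\<^esub>) g ` A" "infinite Y"
    and comm: "\<And>x y. x \<in> Y \<Longrightarrow> y \<in> Y \<Longrightarrow> x \<otimes>\<^bsub>G\<^esub> y = y \<otimes>\<^bsub>G\<^esub> x"
    using T_group_infinite_commuting_subset[OF T] by metis
  from Y(1) obtain B where B: "B \<subseteq> A" "Y = (\<otimes>\<^bsub>G\<^esub>) g ` B"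
    by (meson subset_image_iff)
  with Y(2) have "infinite B" by blast
  with B comm show ?thesis by blast
qed

theorem corollary2p19:
  fixes G :: "('a, 'b) monoid_scheme" and m n :: nat
  assumes "2 \<le> m" and "m \<le> 3" and "1 \<le> n"
    and "T_group m n G"
    and "infinite (carrier G)"
  shows "comm_group G"
proof -
  interpret group G using assms(4) by (simp add: T_group_def)
  note T = \<open>T_group m n G\<close>
  have "g \<otimes>\<^bsub>G\<^esub> h = h \<otimes>\<^bsub>G\<^esub> g" if [simp]: "g \<in> carrier G" "h \<in> carrier G" for g h
  proof (rule ccontr)
    assume gh: "g \<otimes>\<^bsub>G\<^esub> h \<noteq> h \<otimes>\<^bsub>G\<^esub> g"
    \<comment> \<open>Three nested refinements, \<open>C\<close> inside \<open>B\<close> inside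
      \<open>A\<close>, make \<open>C\<close> commuting together with its translates by
      \<open>g\<close> and by \<open>h\<close>.\<close>
    obtain A where A: "A \<subseteq> carrier G" "infinite A"
      and commA: "\<And>x y. x \<in> A \<Longrightarrow> y \<in> A \<Longrightarrow> x \<otimes>\<^bsub>G\<^esub> y = y \<otimes>\<^bsub>G\<^esub> x"
      using T_group_infinite_commuting_subset[OF T order_refl assms(5)] by metis
    obtain B where B: "B \<subseteq> A" "infinite B"
      and commB: "\<And>a b. a \<in> B \<Longrightarrow> b \<in> B \<Longrightarrow>
        (g \<otimes>\<^bsub>G\<^esub> a) \<otimes>\<^bsub>G\<^esub> (g \<otimes>\<^bsub>G\<^esub> b) = (g \<otimes>\<^bsub>G\<^esub> b) \<otimes>\<^bsub>G\<^esub> (g \<otimes>\<^bsub>G\<^esub> a)"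
      using T_group_infinite_commuting_translate[OF T A \<open>g \<in> carrier G\<close>] by metis
    have "B \<subseteq> carrier G" using A B by blast
    then obtain C where C: "C \<subseteq> B" "infinite C"
      and commC: "\<And>a b. a \<in> C \<Longrightarrow> b \<in> C \<Longrightarrow>
        (h \<otimes>\<^bsub>G\<^esub> a) \<otimes>\<^bsub>G\<^esub> (h \<otimes>\<^bsub>G\<^esub> b) = (h \<otimes>\<^bsub>G\<^esub> b) \<otimes>\<^bsub>G\<^esub> (h \<otimes>\<^bsub>G\<^esub> a)"
      using T_group_infinite_commuting_translate[OF T _ B(2) \<open>h \<in> carrier G\<close>] by metis
    obtain c where c: "c \<in> C" using infinite_imp_nonempty[OF C(2)] by blast
    have C_carrier: "a \<in> carrier G" if "a \<in> C" for a using that A B C by blast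
    \<comment> \<open>Fixing one denominator \<open>c\<close> keeps the set of quotients infinite
      and lets \<open>commute_quotient\<close> apply to each of its elements.\<close>
    define D where "D = (\<otimes>\<^bsub>G\<^esub>) (inv\<^bsub>G\<^esub> c) ` C"
    have D_carrier: "d \<in> carrier G" if "d \<in> D" for d
      using that C_carrier c by (auto simp: D_def)
    have "inj_on ((\<otimes>\<^bsub>G\<^esub>) (inv\<^bsub>G\<^esub> c)) C"
      using C_carrier c by (intro inj_onI) auto
    then have "infinite D"
      using C(2) by (simp add: D_def finite_image_iff)
    then obtain E where E: "E \<subseteq> D" "card E = n"
      using infinite_arbitrarily_large by blast
    have CC: "a \<otimes>\<^bsub>G\<^esub> b = b \<otimes>\<^bsub>G\<^esub> a" if "a \<in> C" "b \<in> C" for a b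
      using that commA B(1) C(1) by blast
    \<comment> \<open>Stated for an arbitrary \<open>x\<close>, since it serves for \<open>g\<close>
      and \<open>h\<close> and then for the elements of \<open>C\<close> and of \<open>D\<close>
      themselves.\<close>
    have centralize: "x \<otimes>\<^bsub>G\<^esub> d = d \<otimes>\<^bsub>G\<^esub> x"
      if "x \<in> carrier G" "d \<in> D" and x: "\<And>a. a \<in> C \<Longrightarrow>
        (x \<otimes>\<^bsub>G\<^esub> a) \<otimes>\<^bsub>G\<^esub> (x \<otimes>\<^bsub>G\<^esub> c) = (x \<otimes>\<^bsub>G\<^esub> c) \<otimes>\<^bsub>G\<^esub> (x \<otimes>\<^bsub>G\<^esub> a)" for x d
    proof -
      obtain a where "a \<in> C" "d = inv\<^bsub>G\<^esub> c \<otimes>\<^bsub>G\<^esub> a"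
        using \<open>d \<in> D\<close> by (auto simp: D_def)
      then show ?thesis
        using commute_quotient[OF \<open>x \<in> carrier G\<close> C_carrier C_carrier CC x] c by simp
    qed
    have Dg: "g \<otimes>\<^bsub>G\<^esub> d = d \<otimes>\<^bsub>G\<^esub> g" if "d \<in> D" for d
      by (rule centralize) (use that commB c C(1) in auto)
    have Dh: "h \<otimes>\<^bsub>G\<^esub> d = d \<otimes>\<^bsub>G\<^esub> h" if "d \<in> D" for d
      by (rule centralize) (use that commC c in auto)
    \<comment> \<open>For \<open>x\<close> in \<open>C\<close> the translates of \<open>C\<close> by
      \<open>x\<close> commute because \<open>C\<close> is commuting. Thus \<open>C\<close>
      centralizes \<open>D\<close>, and the same argument with \<open>d\<close> in place of
      \<open>x\<close> then shows that \<open>D\<close> is commuting.\<close>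
    have CD: "x \<otimes>\<^bsub>G\<^esub> d = d \<otimes>\<^bsub>G\<^esub> x" if "x \<in> C" "d \<in> D" for x d
      by (rule centralize)
        (use commute_translates_iff[of x x _ c] that c C_carrier CC in blast)+
    have DD: "d \<otimes>\<^bsub>G\<^esub> e = e \<otimes>\<^bsub>G\<^esub> d" if "d \<in> D" "e \<in> D" for d e
      by (rule centralize)
        (use commute_translates_iff[of d d _ c] that c C_carrier D_carrier CC CD[symmetric] in blast)+
    \<comment> \<open>The bound \<open>m \<le> 3\<close> enters here: \<open>g\<close>,
      \<open>h\<close> and \<open>g h\<close> are three pairwise non-commuting elements, all
      centralizing \<open>D\<close>. For \<open>m = 2\<close> only \<open>g\<close> and
      \<open>h\<close> occur among the relevant indices.\<close>
    define t where "t i = (if i = 1 then g else if i = 2 then h else g \<otimes>\<^bsub>G\<^esub> h)" for i :: nat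
    have t_carrier [simp]: "t i \<in> carrier G" for i
      by (simp add: t_def)
    have tD: "t i \<otimes>\<^bsub>G\<^esub> d = d \<otimes>\<^bsub>G\<^esub> t i" if "d \<in> D" for i d
    proof -
      have "(g \<otimes>\<^bsub>G\<^esub> h) \<otimes>\<^bsub>G\<^esub> d = g \<otimes>\<^bsub>G\<^esub> d \<otimes>\<^bsub>G\<^esub> h"
        using D_carrier[OF that] by (simp add: m_assoc Dh[OF that])
      also have "\<dots> = d \<otimes>\<^bsub>G\<^esub> (g \<otimes>\<^bsub>G\<^esub> h)"
        using D_carrier[OF that] by (simp add: m_assoc Dg[OF that])
      finally show ?thesis
        using Dg Dh that by (simp add: t_def)
    qed
    \<comment> \<open>Cancelling \<open>g\<close> on the left here, and \<open>h\<close> on the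
      right in \<open>h_gh\<close>, reduces both claims to \<open>gh\<close>.\<close>
    have g_gh: "g \<otimes>\<^bsub>G\<^esub> (g \<otimes>\<^bsub>G\<^esub> h) \<noteq> g \<otimes>\<^bsub>G\<^esub> h \<otimes>\<^bsub>G\<^esub> g"
      using gh by (simp add: m_assoc)
    have h_gh: "h \<otimes>\<^bsub>G\<^esub> (g \<otimes>\<^bsub>G\<^esub> h) \<noteq> g \<otimes>\<^bsub>G\<^esub> h \<otimes>\<^bsub>G\<^esub> h"
      using gh by (simp add: m_assoc[symmetric])
    have tt: "t i \<otimes>\<^bsub>G\<^esub> t j \<noteq> t j \<otimes>\<^bsub>G\<^esub> t i" if "i \<in> {1..m}" "j \<in> {1..m}" "i \<noteq> j" for i j
    proof -
      have "i \<in> {1, 2, 3}" "j \<in> {1, 2, 3}" using that assms(2) by auto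
      then show ?thesis
        using \<open>i \<noteq> j\<close> gh gh[symmetric] g_gh g_gh[symmetric] h_gh h_gh[symmetric]
        by (auto simp: t_def)
    qed
    \<comment> \<open>One set \<open>E\<close> serves for all indices: its elements commute with
      each other and with every \<open>t i\<close>, so whether elements of \<open>S i\<close> and
      \<open>S j\<close> commute depends only on \<open>t i\<close> and \<open>t j\<close>.\<close>
    define S where "S i = (\<otimes>\<^bsub>G\<^esub>) (t i) ` E" for i
    have "\<forall>i\<in>{1..m}. S i \<subseteq> carrier G \<and> card (S i) = n"
    proof
      fix i
      have "inj_on ((\<otimes>\<^bsub>G\<^esub>) (t i)) E"
        using E(1) D_carrier t_carrier inj_on_cmult inj_on_subset by (metis subset_iff)
      then show "S i \<subseteq> carrier G \<and> card (S i) = n"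
        using E D_carrier by (auto simp: S_def card_image)
    qed
    with T obtain i j x y where ij: "i \<in> {1..m}" "j \<in> {1..m}" "i \<noteq> j"
      and xy: "x \<in> S i" "y \<in> S j" "x \<otimes>\<^bsub>G\<^esub> y = y \<otimes>\<^bsub>G\<^esub> x"
      unfolding T_group_def by metis
    from xy obtain d e where "d \<in> D" "e \<in> D" "x = t i \<otimes>\<^bsub>G\<^esub> d" "y = t j \<otimes>\<^bsub>G\<^esub> e"
      using E(1) by (auto simp: S_def)
    with xy(3) have "t i \<otimes>\<^bsub>G\<^esub> t j = t j \<otimes>\<^bsub>G\<^esub> t i"
      using commute_translates_iff[of "t i" "t j" d e] D_carrier tD DD by auto
    with tt ij show False by blast
  qed
  then show ?thesis
    by (intro group_comm_groupI) auto
qed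

end
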